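(* Let $\mathcal{A}$ be any alphabet set (a discrete set, finite or infinite, or a metric space $(\mathcal{A},d)$), let $(\Omega,\sigma)$ be a subshift of $(\mathcal{A}^{\mathbb{N}},\sigma)$, and let $\overline{\sigma}$ be the induced map on the hyperspace $\mathcal{K}(\Omega)$ of nonempty compact subsets of $\Omega$. Then $(\Omega,\sigma)$ is cofinitely sensitive if and only if $(\mathcal{K}(\Omega),\overline{\sigma})$ is cofinitely sensitive.
   Context: Sequences are indexed from $0$ and $\sigma(x_0x_1x_2\ldots)=x_1x_2x_3\ldots$. A subshift of $\mathcal{A}^{\mathbb{N}}$ is a nonempty closed subset $\Omega$ with $\sigma(\Omega)\subseteq\Omega$. The space $\mathcal{A}^{\mathbb{N}}$ carries the metric $D$, where $D(\bar x,\bar y)=\sum_{i=0}^\infty \frac{\delta(x_i,y_i)}{2^i}$ ($\delta$ the discrete metric) if $\mathcal{A}$ is a discrete alphabet, and $D(\bar x,\bar y)=\sum_{i=0}^\infty \frac{1}{2^i}\frac{d(x_i,y_i)}{1+d(x_i,y_i)}$ if $\mathcal{A}$ is a general metric space. $\mathcal{K}(\Omega)$ carries the Hausdorff metric $D_H$ induced by $D$, and $\overline{\sigma}(K)=\sigma(K)$. For a continuous self-map $f$ of a metric space $(X,\rho)$, $U\subseteq X$ and $\delta>0$, let $N_f(U,\delta)=\{n\in\mathbb{N}: \exists\, y,z\in U,\ \rho(f^n(y),f^n(z))>\delta\}$. The map $f$ is cofinitely sensitive if there exists $\delta>0$ such that for every nonempty open $U\subseteq X$ the set $N_f(U,\delta)$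 is cofinite in $\mathbb{N}$. *)

theory Defs
  imports "HOL-Analysis.Analysis"
begin

section \<open>Sequences over an alphabet\<close>

text \<open>The two kinds of alphabet are kept apart because they are given different metrics on
  sequences: over a discrete alphabet the letters contribute \<open>\<delta>(x\<^sub>i, y\<^sub>i)\<close>, over a metric
  alphabet they contribute \<open>d(x\<^sub>i, y\<^sub>i) / (1 + d(x\<^sub>i, y\<^sub>i))\<close>.\<close>

datatype 'a alphabet = Discrete "'a set" | Metric "'a metric"

fun letters :: "'a alphabet \<Rightarrow> 'a set" where
  "letters (Discrete A) = A"
| "letters (Metric m) = mspace m"

fun letter_dist :: "'a alphabet \<Rightarrow> 'a \<Rightarrow> 'a \<Rightarrow> real" where
  "letter_dist (Discrete A) a b = discrete_metric.dd a b"
| "letter_dist (Metric m) a b = mdist m a b / (1 + mdist m a b)"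

definition seqs :: "'a alphabet \<Rightarrow> (nat \<Rightarrow> 'a) set" where
  "seqs \<A> = {x. range x \<subseteq> letters \<A>}"

definition seq_dist :: "'a alphabet \<Rightarrow> (nat \<Rightarrow> 'a) \<Rightarrow> (nat \<Rightarrow> 'a) \<Rightarrow> real" where
  "seq_dist \<A> x y = (\<Sum>i. letter_dist \<A> (x i) (y i) / 2 ^ i)"

definition seq_metric :: "'a alphabet \<Rightarrow> (nat \<Rightarrow> 'a) metric" where
  "seq_metric \<A> = metric (seqs \<A>, seq_dist \<A>)"

lemma Metric_space_letters: "Metric_space (letters \<A>) (letter_dist \<A>)"
proof (cases \<A>)
  case (Discrete A)
  then show ?thesis
    by (auto simp: discrete_metric.dd_def intro!: Metric_space.intro split: if_splits)
next
  case (Metric m)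
  have sub: "s / (1 + s) \<le> t / (1 + t) + u / (1 + u)"
    if "0 \<le> s" "0 \<le> t" "0 \<le> u" "s \<le> t + u" for s t u :: real
  proof -
    have "s / (1 + s) \<le> (t + u) / (1 + (t + u))"
      using that by (simp add: divide_simps) (simp add: algebra_simps)
    also have "\<dots> = t / (1 + (t + u)) + u / (1 + (t + u))"
      by (simp add: add_divide_distrib)
    also have "\<dots> \<le> t / (1 + t) + u / (1 + u)"
      using that by (intro add_mono divide_left_mono) auto
    finally show ?thesis .
  qed
  show ?thesis
  proof (rule Metric_space.intro)
    fix x y
    show "0 \<le> letter_dist \<A> x y" "letter_dist \<A> x y = letter_dist \<A> y x"
      using Metric by (simp_all add: mdist_commute)
  next
    fix x y
    assume "x \<in> letters \<A>" "y \<in> letters \<A>"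
    moreover have "1 + mdist m x y > 0"
      by (simp add: add_pos_nonneg)
    ultimately show "letter_dist \<A> x y = 0 \<longleftrightarrow> x = y"
      using Metric by auto
  next
    fix x y z
    assume "x \<in> letters \<A>" "y \<in> letters \<A>" "z \<in> letters \<A>"
    then show "letter_dist \<A> x z \<le> letter_dist \<A> x y + letter_dist \<A> y z"
      using Metric by (auto intro!: sub mdist_triangle)
  qed
qed

lemma letter_dist_nonneg: "0 \<le> letter_dist \<A> a b"
  by (rule Metric_space.nonneg[OF Metric_space_letters])

lemma letter_dist_le_1: "letter_dist \<A> a b \<le> 1"
proof (cases \<A>)
  case (Metric m)
  have "1 + mdist m a b > 0"
    by (simp add: add_pos_nonneg)
  then show ?thesis
    using Metric by (simp add: divide_simps)
qed (simp add: discrete_metric.dd_def)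

lemma summable_letter_dist: "summable (\<lambda>i. letter_dist \<A> (x i) (y i) / 2 ^ i)"
proof (rule summable_comparison_test')
  show "summable (\<lambda>i. (1 / 2 :: real) ^ i)"
    by (rule summable_geometric) simp
  show "norm (letter_dist \<A> (x i) (y i) / 2 ^ i) \<le> (1 / 2) ^ i" if "i \<ge> 0" for i
    using letter_dist_nonneg[of \<A> "x i" "y i"] letter_dist_le_1[of \<A> "x i" "y i"]
    by (simp add: power_divide divide_right_mono)
qed

lemma Metric_space_seqs: "Metric_space (seqs \<A>) (seq_dist \<A>)"
proof (rule Metric_space.intro)
  fix x y
  show "0 \<le> seq_dist \<A> x y"
    unfolding seq_dist_def
    by (rule suminf_nonneg[OF summable_letter_dist]) (simp add: letter_dist_nonneg)
  show "seq_dist \<A> x y = seq_dist \<A> y x"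
    unfolding seq_dist_def by (simp add: Metric_space.commute[OF Metric_space_letters])
next
  fix x y
  assume xy: "x \<in> seqs \<A>" "y \<in> seqs \<A>"
  have "seq_dist \<A> x y = 0 \<longleftrightarrow> (\<forall>i. letter_dist \<A> (x i) (y i) / 2 ^ i = 0)"
    unfolding seq_dist_def
    by (rule suminf_eq_zero_iff[OF summable_letter_dist]) (simp add: letter_dist_nonneg)
  also have "\<dots> \<longleftrightarrow> (\<forall>i. x i = y i)"
    using xy by (simp add: seqs_def image_subset_iff Metric_space.zero[OF Metric_space_letters])
  finally show "seq_dist \<A> x y = 0 \<longleftrightarrow> x = y"
    by auto
next
  fix x y z
  assume xyz: "x \<in> seqs \<A>" "y \<in> seqs \<A>" "z \<in> seqs \<A>"
  have "letter_dist \<A> (x i) (z i) / 2 ^ i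
      \<le> letter_dist \<A> (x i) (y i) / 2 ^ i + letter_dist \<A> (y i) (z i) / 2 ^ i" for i
    using Metric_space.triangle[OF Metric_space_letters, of "x i" \<A> "y i" "z i"] xyz
    by (simp add: seqs_def image_subset_iff divide_right_mono flip: add_divide_distrib)
  then show "seq_dist \<A> x z \<le> seq_dist \<A> x y + seq_dist \<A> y z"
    unfolding seq_dist_def suminf_add[OF summable_letter_dist summable_letter_dist]
    by (intro suminf_le summable_add summable_letter_dist)
qed

lemma mspace_seq_metric [simp]: "mspace (seq_metric \<A>) = seqs \<A>"
  by (simp add: seq_metric_def Metric_space.mspace_metric Metric_space_seqs)

lemma mdist_seq_metric [simp]: "mdist (seq_metric \<A>) = seq_dist \<A>"
  by (simp add: seq_metric_def Metric_space.mdist_metric Metric_space_seqs)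

definition shift :: "(nat \<Rightarrow> 'a) \<Rightarrow> (nat \<Rightarrow> 'a)" where
  "shift x = (\<lambda>i. x (Suc i))"

definition subshift :: "'a alphabet \<Rightarrow> (nat \<Rightarrow> 'a) set \<Rightarrow> bool" where
  "subshift \<A> \<Omega> \<longleftrightarrow>
     \<Omega> \<noteq> {} \<and> closedin (mtopology_of (seq_metric \<A>)) \<Omega> \<and> shift ` \<Omega> \<subseteq> \<Omega>"


section \<open>The hyperspace of nonempty compact sets\<close>

definition hausdorff_dist :: "('a \<Rightarrow> 'a \<Rightarrow> real) \<Rightarrow> 'a set \<Rightarrow> 'a set \<Rightarrow> real" where
  "hausdorff_dist d K L = max (SUP x\<in>K. INF y\<in>L. d x y) (SUP y\<in>L. INF x\<in>K. d x y)"

definition nonempty_compacts :: "'a metric \<Rightarrow> 'a set set" where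
  "nonempty_compacts m = {K. K \<noteq> {} \<and> compactin (mtopology_of m) K}"

text \<open>The library's metrics must be nonnegative on the whole type, which \<open>hausdorff_dist\<close> is
  not known to be, since its suprema may be taken over unbounded sets. Hence the distance
  \<open>0\<close> off the carrier, where its value plays no role.\<close>

definition hyperspace :: "'a metric \<Rightarrow> 'a set metric" where
  "hyperspace m = metric (nonempty_compacts m, \<lambda>K L.
     if K \<in> nonempty_compacts m \<and> L \<in> nonempty_compacts m
     then hausdorff_dist (mdist m) K L else 0)"

lemma hausdorff_dist_le_iff:
  assumes "K \<in> nonempty_compacts m" "L \<in> nonempty_compacts m"
  shows "hausdorff_dist (mdist m) K L \<le> r \<longleftrightarrow>
    (\<forall>x\<in>K. (INF y\<in>L. mdist m x y) \<le> r) \<and> (\<forall>y\<in>L. (INF x\<in>K. mdist m x y) \<le> r)"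
proof -
  interpret Metric_space "mspace m" "mdist m"
    by simp
  have KL: "compactin mtopology K" "compactin mtopology L" "K \<noteq> {}" "L \<noteq> {}"
    using assms by (auto simp: nonempty_compacts_def mtopology_of_def)
  then have "mbounded (K \<union> L)"
    by (simp add: compactin_imp_mbounded mbounded_Un)
  then obtain B where B: "\<And>x y. x \<in> K \<union> L \<Longrightarrow> y \<in> K \<union> L \<Longrightarrow> mdist m x y \<le> B"
    unfolding mbounded_alt by blast
  have bb: "bdd_below (f ` S)" if "\<And>z. 0 \<le> f z" for f :: "'a \<Rightarrow> real" and S
    using that by (auto intro!: bdd_belowI[of _ 0])
  obtain k l where kl: "k \<in> K" "l \<in> L"
    using KL by blast
  have "bdd_above ((\<lambda>x. INF y\<in>L. mdist m x y) ` K)"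
    using kl B by (intro bdd_aboveI2[of _ _ B] cINF_lower2[of _ _ l]) (auto intro!: bb)
  moreover have "bdd_above ((\<lambda>y. INF x\<in>K. mdist m x y) ` L)"
    using kl B by (intro bdd_aboveI2[of _ _ B] cINF_lower2[of _ _ k]) (auto intro!: bb)
  ultimately show ?thesis
    using KL by (simp add: hausdorff_dist_def cSUP_le_iff)
qed

lemma Metric_space_hyperspace:
  "Metric_space (nonempty_compacts m) (\<lambda>K L.
     if K \<in> nonempty_compacts m \<and> L \<in> nonempty_compacts m
     then hausdorff_dist (mdist m) K L else 0)"
proof -
  interpret Metric_space "mspace m" "mdist m"
    by simp
  let ?C = "nonempty_compacts m" and ?H = "hausdorff_dist (mdist m)"
  have comm: "?H K L = ?H L K" for K L
    by (simp add: hausdorff_dist_def max.commute commute)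
  have closed: "closedin mtopology K" if "K \<in> ?C" for K
    using that by (auto simp: nonempty_compacts_def mtopology_of_def compactin_imp_closedin
        Hausdorff_space_mtopology)
  have sub: "K \<subseteq> mspace m" if "K \<in> ?C" for K
    using closed[OF that] closedin_subset by fastforce
  have ne: "K \<noteq> {}" if "K \<in> ?C" for K
    using that by (simp add: nonempty_compacts_def)
  have bb: "bdd_below (mdist m x ` S)" for x S
    by (auto intro!: bdd_belowI[of _ 0])
  have near: "\<exists>y\<in>L. mdist m x y < r" if "K \<in> ?C" "L \<in> ?C" "?H K L < r" "x \<in> K" for K L x r
  proof -
    have "(INF y\<in>L. mdist m x y) < r"
      using hausdorff_dist_le_iff[OF that(1,2), of "?H K L"] that by fastforce
    then show ?thesis
      using ne[OF that(2)] bb by (simp add: cINF_less_iff)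
  qed
  have leI: "?H K L \<le> r"
    if "K \<in> ?C" "L \<in> ?C"
      "\<And>x e. x \<in> K \<Longrightarrow> e > 0 \<Longrightarrow> \<exists>y\<in>L. mdist m x y \<le> r + e"
      "\<And>y e. y \<in> L \<Longrightarrow> e > 0 \<Longrightarrow> \<exists>x\<in>K. mdist m y x \<le> r + e" for K L r
  proof -
    have *: "(INF y\<in>L. mdist m x y) \<le> r" if "\<And>e. e > 0 \<Longrightarrow> \<exists>y\<in>L. mdist m x y \<le> r + e" for x L
    proof (rule field_le_epsilon)
      fix e :: real
      assume "e > 0"
      then show "(INF y\<in>L. mdist m x y) \<le> r + e"
        using that bb by (meson cINF_lower2)
    qed
    show ?thesis
      unfolding hausdorff_dist_le_iff[OF that(1,2)] using that(3,4) *
      by (simp add: commute[of _ y for y])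
  qed
  have nonneg': "0 \<le> ?H K L" if "K \<in> ?C" "L \<in> ?C" for K L
  proof -
    obtain x where x: "x \<in> K"
      using ne[OF \<open>K \<in> ?C\<close>] by blast
    have "0 \<le> (INF y\<in>L. mdist m x y)"
      using ne[OF that(2)] by (intro cINF_greatest) auto
    also have "\<dots> \<le> ?H K L"
      using hausdorff_dist_le_iff[OF that, of "?H K L"] x by simp
    finally show ?thesis .
  qed
  have refl: "?H K K = 0" if K: "K \<in> ?C" for K
  proof (rule antisym[OF leI[OF K K] nonneg'[OF K K]])
    fix x and e :: real
    assume "x \<in> K" "e > 0"
    then show "\<exists>y\<in>K. mdist m x y \<le> 0 + e" "\<exists>y\<in>K. mdist m x y \<le> 0 + e"
      using sub[OF K] by (auto intro!: bexI[of _ x])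
  qed
  have subset: "K \<subseteq> L" if "K \<in> ?C" "L \<in> ?C" "?H K L = 0" for K L
  proof
    fix x
    assume x: "x \<in> K"
    have "\<exists>y\<in>L. y \<in> mball x r" if "r > 0" for r
      using near[OF \<open>K \<in> ?C\<close> \<open>L \<in> ?C\<close> _ x, of r] sub[OF \<open>K \<in> ?C\<close>] sub[OF \<open>L \<in> ?C\<close>]
        \<open>?H K L = 0\<close> that x by auto
    then have "x \<in> mtopology closure_of L"
      using sub[OF \<open>K \<in> ?C\<close>] x by (auto simp: metric_closure_of)
    then show "x \<in> L"
      using closed[OF \<open>L \<in> ?C\<close>] by (simp add: closure_of_closedin)
  qed
  have eq: "?H K L = 0 \<longleftrightarrow> K = L" if "K \<in> ?C" "L \<in> ?C" for K L
    using subset[OF that] subset[OF that(2,1)] comm[of K L] refl that by auto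
  have step: "\<exists>z\<in>P. mdist m x z \<le> ?H K L + ?H L P + e"
    if C: "K \<in> ?C" "L \<in> ?C" "P \<in> ?C" and "x \<in> K" "e > 0" for K L P x e
  proof -
    obtain y where y: "y \<in> L" "mdist m x y < ?H K L + e / 2"
      using near[OF C(1,2) _ \<open>x \<in> K\<close>, of "?H K L + e / 2"] \<open>e > 0\<close> by auto
    obtain z where z: "z \<in> P" "mdist m y z < ?H L P + e / 2"
      using near[OF C(2,3) _ \<open>y \<in> L\<close>, of "?H L P + e / 2"] \<open>e > 0\<close> by auto
    have "mdist m x z \<le> mdist m x y + mdist m y z"
      using sub C \<open>x \<in> K\<close> y z by (intro triangle) auto
    then show ?thesis
      using y z by (intro bexI[of _ z]) auto
  qed
  have tri: "?H K P \<le> ?H K L + ?H L P" if C: "K \<in> ?C" "L \<in> ?C" "P \<in> ?C" for K L P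
  proof (rule leI[OF C(1,3)])
    fix x and e :: real
    assume "x \<in> K" "e > 0"
    then show "\<exists>z\<in>P. mdist m x z \<le> ?H K L + ?H L P + e"
      using step C by blast
  next
    fix z and e :: real
    assume "z \<in> P" "e > 0"
    then show "\<exists>x\<in>K. mdist m z x \<le> ?H K L + ?H L P + e"
      using step[OF C(3,2,1)] by (simp add: comm[of P L] comm[of L K] add.commute)
  qed
  show ?thesis
    by (rule Metric_space.intro) (auto simp: nonneg' comm eq tri)
qed

lemma mspace_hyperspace [simp]: "mspace (hyperspace m) = nonempty_compacts m"
  unfolding hyperspace_def by (rule Metric_space.mspace_metric[OF Metric_space_hyperspace])

lemma mdist_hyperspace:
  assumes "K \<in> nonempty_compacts m" "L \<in> nonempty_compacts m"
  shows "mdist (hyperspace m) K L = hausdorff_dist (mdist m) K L"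
  unfolding hyperspace_def Metric_space.mdist_metric[OF Metric_space_hyperspace]
  using assms by simp


section \<open>Cofinite sensitivity\<close>

text \<open>The map \<open>f\<close> is meant to be a continuous self-map of \<open>mspace m\<close>; its values elsewhere
  are irrelevant.\<close>

definition sensitive_times :: "'a metric \<Rightarrow> ('a \<Rightarrow> 'a) \<Rightarrow> 'a set \<Rightarrow> real \<Rightarrow> nat set" where
  "sensitive_times m f U \<delta> = {n. \<exists>y\<in>U. \<exists>z\<in>U. mdist m ((f ^^ n) y) ((f ^^ n) z) > \<delta>}"

definition cofinitely_sensitive :: "'a metric \<Rightarrow> ('a \<Rightarrow> 'a) \<Rightarrow> bool" where
  "cofinitely_sensitive m f \<longleftrightarrow>
     (\<exists>\<delta>>0. \<forall>U. openin (mtopology_of m) U \<and> U \<noteq> {} \<longrightarrow> finite (- sensitive_times m f U \<delta>))"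

end

theory Submission
  imports Defs
begin

text \<open>Both directions hold for any self-map of a metric space. If \<open>f\<close> is cofinitely sensitive,
  a hyperspace neighbourhood contains a finite set \<open>F\<close> together with all its small perturbations;
  at a time that is sensitive for the balls around all points of \<open>F\<close>, every point of \<open>F\<close> can be
  moved slightly so that its image ends up far from the image of one fixed point of \<open>F\<close>. For the
  converse, a small hyperspace ball around a singleton consists of subsets of a small ball.\<close>

lemma image_funpow: "(image f ^^ n) K = (f ^^ n) ` K" for f :: "'a \<Rightarrow> 'a"
  by (induction n) (simp_all add: image_image)

lemma funpow_closed: "f ` S \<subseteq> S \<Longrightarrow> x \<in> S \<Longrightarrow> (f ^^ n) x \<in> S"
  by (induction n) auto

lemma mdist_self: "x \<in> mspace m \<Longrightarrow> mdist m x x = 0"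
  by simp

lemma nonempty_compacts_subset: "K \<in> nonempty_compacts m \<Longrightarrow> K \<subseteq> mspace m"
  using compactin_subset_topspace by (fastforce simp: nonempty_compacts_def)

lemma finite_in_nonempty_compacts:
  assumes "finite F" "F \<noteq> {}" "F \<subseteq> mspace m"
  shows "F \<in> nonempty_compacts m"
  using assms by (simp add: nonempty_compacts_def finite_imp_compactin)

lemma bdd_below_mdist: "bdd_below ((\<lambda>y. mdist m (f y) (g y)) ` S)"
  by (auto intro!: bdd_belowI[of _ 0])

lemma hausdorff_dist_leI:
  assumes "K \<in> nonempty_compacts m" "L \<in> nonempty_compacts m"
    and "\<And>x. x \<in> K \<Longrightarrow> \<exists>y\<in>L. mdist m x y \<le> r"
    and "\<And>y. y \<in> L \<Longrightarrow> \<exists>x\<in>K. mdist m x y \<le> r"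
  shows "hausdorff_dist (mdist m) K L \<le> r"
  unfolding hausdorff_dist_le_iff[OF assms(1,2)]
proof (intro conjI ballI)
  fix x assume "x \<in> K"
  then obtain y where "y \<in> L" "mdist m x y \<le> r"
    using assms(3) by blast
  then show "(INF y\<in>L. mdist m x y) \<le> r"
    by (rule cINF_lower2[OF bdd_below_mdist])
next
  fix y assume "y \<in> L"
  then obtain x where "x \<in> K" "mdist m x y \<le> r"
    using assms(4) by blast
  then show "(INF x\<in>K. mdist m x y) \<le> r"
    by (rule cINF_lower2[OF bdd_below_mdist])
qed

text \<open>An infimum lying strictly below \<open>r\<close> is undercut by an actual point, so the
  strict bound yields witnesses without any minimum having to be attained.\<close>

lemma hausdorff_dist_less_imp_near:
  assumes "K \<in> nonempty_compacts m" "L \<in> nonempty_compacts m"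
    and "hausdorff_dist (mdist m) K L < r"
  shows "x \<in> K \<Longrightarrow> \<exists>y\<in>L. mdist m x y < r"
    and "y \<in> L \<Longrightarrow> \<exists>x\<in>K. mdist m x y < r"
proof -
  have ne: "K \<noteq> {}" "L \<noteq> {}"
    using assms by (auto simp: nonempty_compacts_def)
  have *: "\<forall>x\<in>K. (INF y\<in>L. mdist m x y) < r" "\<forall>y\<in>L. (INF x\<in>K. mdist m x y) < r"
    using hausdorff_dist_le_iff[OF assms(1,2), of "hausdorff_dist (mdist m) K L"] assms(3)
    by fastforce+
  show "x \<in> K \<Longrightarrow> \<exists>y\<in>L. mdist m x y < r"
    using *(1) ne by (simp add: cINF_less_iff bdd_below_mdist)
  show "y \<in> L \<Longrightarrow> \<exists>x\<in>K. mdist m x y < r"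
    using *(2) ne by (simp add: cINF_less_iff bdd_below_mdist)
qed

lemma openin_metric_iff:
  "openin (mtopology_of m) U \<longleftrightarrow>
     U \<subseteq> mspace m \<and> (\<forall>x\<in>U. \<exists>r>0. \<forall>y\<in>mspace m. mdist m x y < r \<longrightarrow> y \<in> U)"
proof -
  interpret Metric_space "mspace m" "mdist m"
    by simp
  show ?thesis
    unfolding mtopology_of_def openin_mtopology by (fastforce simp: subset_iff)
qed

lemma openin_metric_ball:
  "openin (mtopology_of m) {y \<in> mspace m. mdist m x y < r}" if "x \<in> mspace m"
proof -
  interpret Metric_space "mspace m" "mdist m"
    by simp
  have "{y \<in> mspace m. mdist m x y < r} = mball x r"
    using that by auto
  then show ?thesis
    by (simp add: mtopology_of_def)
qed

text \<open>Compact sets are totally bounded. Since the centres lie in \<open>K\<close> itself,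
  \<open>F\<close> is a finite approximation of \<open>K\<close> in the Hausdorff distance.\<close>

lemma nonempty_compacts_finite_net:
  assumes "K \<in> nonempty_compacts m" "e > 0"
  obtains F where "finite F" "F \<noteq> {}" "F \<subseteq> K" "\<And>x. x \<in> K \<Longrightarrow> \<exists>y\<in>F. mdist m y x < e"
proof -
  interpret Metric_space "mspace m" "mdist m"
    by simp
  have "mtotally_bounded K"
    using assms by (simp add: nonempty_compacts_def mtopology_of_def compactin_imp_mtotally_bounded)
  then have "\<exists>F. finite F \<and> F \<subseteq> K \<and> K \<subseteq> (\<Union>x\<in>F. mball x e)"
    using \<open>e > 0\<close> by (simp add: mtotally_bounded_def)
  then obtain F where "finite F" "F \<subseteq> K" "K \<subseteq> (\<Union>x\<in>F. mball x e)"
    by blast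
  moreover have "K \<noteq> {}"
    using assms by (simp add: nonempty_compacts_def)
  ultimately show ?thesis
    by (intro that[of F]) (use in_mball in blast)+
qed

lemma cofinitely_sensitive_hyperspace:
  assumes f: "f ` mspace m \<subseteq> mspace m" and "cofinitely_sensitive m f"
  shows "cofinitely_sensitive (hyperspace m) (image f)"
proof -
  obtain \<delta> where "\<delta> > 0" and \<delta>: "\<And>U. openin (mtopology_of m) U \<Longrightarrow> U \<noteq> {} \<Longrightarrow>
      finite (- sensitive_times m f U \<delta>)"
    using assms(2) unfolding cofinitely_sensitive_def by blast
  \<comment> \<open>The construction yields a Hausdorff distance of at least
    \<open>\<delta> / 2\<close>, possibly with equality; \<open>\<delta> / 4\<close> restores the
    strict inequality.\<close>
  have "finite (- sensitive_times (hyperspace m) (image f) W (\<delta> / 4))"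
    if W: "openin (mtopology_of (hyperspace m)) W" "W \<noteq> {}" for W
  proof -
    obtain K where K: "K \<in> W"
      using W by blast
    obtain e where "e > 0" and e: "\<And>L. L \<in> nonempty_compacts m \<Longrightarrow>
        mdist (hyperspace m) K L < e \<Longrightarrow> L \<in> W"
      using W(1) K unfolding openin_metric_iff by auto
    have KC: "K \<in> nonempty_compacts m"
      using W(1) K unfolding openin_metric_iff by auto
    \<comment> \<open>The net error and the later displacement of net points each cost
      \<open>e / 4\<close>, for a total of \<open>e / 2 < e\<close>.\<close>
    obtain F where F: "finite F" "F \<noteq> {}" "F \<subseteq> K" "\<And>x. x \<in> K \<Longrightarrow> \<exists>y\<in>F. mdist m y x < e / 4"
      using nonempty_compacts_finite_net[OF KC, of "e / 4"] \<open>e > 0\<close> by auto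
    have Fm: "F \<subseteq> mspace m" "K \<subseteq> mspace m"
      using F nonempty_compacts_subset[OF KC] by auto
    \<comment> \<open>Stated for an arbitrary displacement \<open>w\<close>, because it is used both
      for \<open>id\<close> and for the displacement chosen by sensitivity.\<close>
    have perturb: "w ` F \<in> nonempty_compacts m" "w ` F \<in> W"
      if w: "\<And>x. x \<in> F \<Longrightarrow> w x \<in> mspace m \<and> mdist m x (w x) < e / 4" for w
    proof -
      show C: "w ` F \<in> nonempty_compacts m"
        using F w by (intro finite_in_nonempty_compacts) auto
      have "hausdorff_dist (mdist m) K (w ` F) \<le> e / 2"
      proof (rule hausdorff_dist_leI[OF KC C])
        fix x assume x: "x \<in> K"
        then obtain y where y: "y \<in> F" "mdist m y x < e / 4"
          using F by blast
        have "mdist m x (w y) \<le> mdist m x y + mdist m y (w y)"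
          using x y w Fm by (intro mdist_triangle) auto
        then show "\<exists>z\<in>w ` F. mdist m x z \<le> e / 2"
          using y w[OF y(1)] by (intro bexI[of _ "w y"]) (auto simp: mdist_commute)
      next
        fix y assume "y \<in> w ` F"
        then show "\<exists>x\<in>K. mdist m x y \<le> e / 2"
          using w F \<open>e > 0\<close> by fastforce
      qed
      then show "w ` F \<in> W"
        using e[OF C] \<open>e > 0\<close> by (simp add: mdist_hyperspace[OF KC C])
    qed
    define U where "U x = {y \<in> mspace m. mdist m x y < e / 4}" for x
    \<comment> \<open>Finiteness of \<open>F\<close> makes all but finitely many times sensitive for
      all the balls \<open>U x\<close> simultaneously.\<close>
    have "finite (\<Union>x\<in>F. - sensitive_times m f (U x) \<delta>)"
    proof (intro finite_UN_I F(1) \<delta>)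
      fix x assume x: "x \<in> F"
      then show "openin (mtopology_of m) (U x)"
        unfolding U_def using Fm by (intro openin_metric_ball) auto
      show "U x \<noteq> {}"
        using x Fm \<open>e > 0\<close> by (auto simp: U_def mdist_self subset_iff intro!: exI[of _ x])
    qed
    moreover have "n \<in> sensitive_times (hyperspace m) (image f) W (\<delta> / 4)"
      if n: "\<And>x. x \<in> F \<Longrightarrow> n \<in> sensitive_times m f (U x) \<delta>" for n
    proof -
      let ?g = "f ^^ n"
      have g: "?g x \<in> mspace m" if "x \<in> mspace m" for x
        using funpow_closed[OF f that] .
      obtain p where p: "p \<in> F"
        using F by blast
      \<comment> \<open>The reference point \<open>p\<close> is the same for every \<open>x\<close>.
        Two points of \<open>U x\<close> with images more than \<open>\<delta>\<close> apart cannot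
        both have images within \<open>\<delta> / 2\<close> of \<open>?g p\<close>.\<close>
      have "\<exists>w. w \<in> U x \<and> mdist m (?g p) (?g w) \<ge> \<delta> / 2" if x: "x \<in> F" for x
      proof -
        obtain y z where yz: "y \<in> U x" "z \<in> U x" "mdist m (?g y) (?g z) > \<delta>"
          using n[OF x] unfolding sensitive_times_def by blast
        have "mdist m (?g y) (?g z) \<le> mdist m (?g y) (?g p) + mdist m (?g p) (?g z)"
          using yz p Fm by (intro mdist_triangle g) (auto simp: U_def)
        then have "mdist m (?g p) (?g y) \<ge> \<delta> / 2 \<or> mdist m (?g p) (?g z) \<ge> \<delta> / 2"
          using yz(3) mdist_commute[of m "?g p" "?g y"] by linarith
        then show ?thesis
          using yz by blast
      qed
      then obtain w where w: "\<And>x. x \<in> F \<Longrightarrow> w x \<in> U x"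
        "\<And>x. x \<in> F \<Longrightarrow> mdist m (?g p) (?g (w x)) \<ge> \<delta> / 2"
        by metis
      have FW: "F \<in> W"
        using perturb(2)[of id] Fm(1) \<open>e > 0\<close> by (auto simp: mdist_self subset_iff)
      have wW: "w ` F \<in> W"
        using w(1) by (intro perturb) (auto simp: U_def)
      \<comment> \<open>Images of finite sets are finite, hence compact, so their
        \<open>hyperspace\<close> distance is the true Hausdorff distance and not the default
        \<open>0\<close>.\<close>
      have C: "?g ` F \<in> nonempty_compacts m" "?g ` w ` F \<in> nonempty_compacts m"
        using F Fm g w(1) by (auto intro!: finite_in_nonempty_compacts simp: U_def)
      \<comment> \<open>The single point \<open>?g p\<close> of the first set is at distance at
        least \<open>\<delta> / 2\<close> from every point of the second.\<close>
      have "\<not> hausdorff_dist (mdist m) (?g ` F) (?g ` w ` F) < \<delta> / 2"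
      proof
        assume "hausdorff_dist (mdist m) (?g ` F) (?g ` w ` F) < \<delta> / 2"
        then obtain y where "y \<in> ?g ` w ` F" "mdist m (?g p) y < \<delta> / 2"
          using hausdorff_dist_less_imp_near(1)[OF C] p by blast
        then show False
          using w(2) by fastforce
      qed
      then have "mdist (hyperspace m) ((image f ^^ n) F) ((image f ^^ n) (w ` F)) > \<delta> / 4"
        using \<open>\<delta> > 0\<close> by (simp add: image_funpow mdist_hyperspace[OF C])
      then show ?thesis
        unfolding sensitive_times_def using FW wW by blast
    qed
    then have "- sensitive_times (hyperspace m) (image f) W (\<delta> / 4) \<subseteq>
        (\<Union>x\<in>F. - sensitive_times m f (U x) \<delta>)"
      by blast
    ultimately show ?thesis
      by (rule finite_subset[rotated])
  qed
  then show ?thesis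
    unfolding cofinitely_sensitive_def using \<open>\<delta> > 0\<close> by (intro exI[of _ "\<delta> / 4"]) auto
qed

text \<open>The same \<open>\<delta>\<close> serves: if the images of two sets are more than
  \<open>\<delta>\<close> apart in the Hausdorff distance, then so are the images of some point of
  one and some point of the other.\<close>

lemma cofinitely_sensitive_if_hyperspace:
  assumes "cofinitely_sensitive (hyperspace m) (image f)"
  shows "cofinitely_sensitive m f"
proof -
  obtain \<delta> where "\<delta> > 0" and \<delta>: "\<And>W. openin (mtopology_of (hyperspace m)) W \<Longrightarrow> W \<noteq> {} \<Longrightarrow>
      finite (- sensitive_times (hyperspace m) (image f) W \<delta>)"
    using assms unfolding cofinitely_sensitive_def by blast
  have "finite (- sensitive_times m f U \<delta>)"
    if U: "openin (mtopology_of m) U" "U \<noteq> {}" for U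
  proof -
    obtain x where x: "x \<in> U"
      using U by blast
    obtain e where "e > 0" and e: "\<And>y. y \<in> mspace m \<Longrightarrow> mdist m x y < e \<Longrightarrow> y \<in> U"
      using U(1) x unfolding openin_metric_iff by blast
    have "x \<in> mspace m"
      using U(1) x unfolding openin_metric_iff by blast
    then have xC: "{x} \<in> nonempty_compacts m"
      by (simp add: finite_in_nonempty_compacts)
    define W where "W = {L \<in> mspace (hyperspace m). mdist (hyperspace m) {x} L < e}"
    have sub: "L \<subseteq> U" if "L \<in> W" for L
    proof -
      have L: "L \<in> nonempty_compacts m" "hausdorff_dist (mdist m) {x} L < e"
        using that xC by (auto simp: W_def mdist_hyperspace)
      show ?thesis
        using e hausdorff_dist_less_imp_near(2)[OF xC L] nonempty_compacts_subset[OF L(1)] by blast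
    qed
    have "sensitive_times (hyperspace m) (image f) W \<delta> \<subseteq> sensitive_times m f U \<delta>"
    proof
      fix n assume "n \<in> sensitive_times (hyperspace m) (image f) W \<delta>"
      then obtain K L where KL: "K \<in> W" "L \<in> W"
        "mdist (hyperspace m) ((f ^^ n) ` K) ((f ^^ n) ` L) > \<delta>"
        unfolding sensitive_times_def image_funpow by blast
      \<comment> \<open>The distance in \<open>hyperspace\<close> is \<open>0\<close> as soon as one
        argument is not a nonempty compact set, so a distance above \<open>\<delta> > 0\<close>
        certifies that both images are.\<close>
      have C: "(f ^^ n) ` K \<in> nonempty_compacts m" "(f ^^ n) ` L \<in> nonempty_compacts m"
        using KL(3) \<open>\<delta> > 0\<close>
        unfolding hyperspace_def Metric_space.mdist_metric[OF Metric_space_hyperspace]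
        by (auto split: if_splits)
      have ne: "K \<noteq> {}" "L \<noteq> {}"
        using C by (auto simp: nonempty_compacts_def)
      show "n \<in> sensitive_times m f U \<delta>"
      proof (rule ccontr)
        assume "n \<notin> sensitive_times m f U \<delta>"
        \<comment> \<open>Both \<open>K\<close> and \<open>L\<close> lie in \<open>U\<close>, so an
          insensitive time bounds all cross distances between their images.\<close>
        then have "mdist m ((f ^^ n) y) ((f ^^ n) z) \<le> \<delta>" if "y \<in> K" "z \<in> L" for y z
          using that sub[OF KL(1)] sub[OF KL(2)] by (force simp: sensitive_times_def)
        then have "hausdorff_dist (mdist m) ((f ^^ n) ` K) ((f ^^ n) ` L) \<le> \<delta>"
          using ne by (intro hausdorff_dist_leI[OF C]) auto
        then show False
          using KL(3) by (simp add: mdist_hyperspace[OF C])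
      qed
    qed
    moreover have "finite (- sensitive_times (hyperspace m) (image f) W \<delta>)"
    proof (rule \<delta>)
      show "openin (mtopology_of (hyperspace m)) W"
        unfolding W_def using xC by (intro openin_metric_ball) simp
      have "{x} \<in> W"
        using xC \<open>e > 0\<close> by (simp add: W_def mdist_self)
      then show "W \<noteq> {}"
        by blast
    qed
    ultimately show ?thesis
      by (meson Compl_anti_mono finite_subset)
  qed
  then show ?thesis
    unfolding cofinitely_sensitive_def using \<open>\<delta> > 0\<close> by blast
qed

theorem proposition3p13:
  fixes \<A> :: "'a alphabet" and \<Omega> :: "(nat \<Rightarrow> 'a) set"
  assumes "subshift \<A> \<Omega>"
  shows "cofinitely_sensitive (submetric (seq_metric \<A>) \<Omega>) shift \<longleftrightarrow>
         cofinitely_sensitive (hyperspace (submetric (seq_metric \<A>) \<Omega>)) (image shift)"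
proof -
  have "\<Omega> \<subseteq> seqs \<A>" "shift ` \<Omega> \<subseteq> \<Omega>"
    using assms closedin_subset by (fastforce simp: subshift_def)+
  \<comment> \<open>The carrier of the submetric is the intersection of \<Omega> with
    \<open>seqs \<A>\<close>, which is \<Omega> itself by the inclusion just shown.\<close>
  then have "shift ` mspace (submetric (seq_metric \<A>) \<Omega>) \<subseteq> mspace (submetric (seq_metric \<A>) \<Omega>)"
    by auto
  then show ?thesis
    using cofinitely_sensitive_hyperspace cofinitely_sensitive_if_hyperspace by blast
qed

end
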